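(* Let $\xi:[0,\ell)\to\mathbb{R}^n$ be a self-contracted curve. Then $$\mathsf{L}(\xi)\le C_n\,\mathsf{W}(\Xi(0))\le C_n\operatorname{diam}(\Xi(0)),$$ where $\Xi(0)=\xi([0,\ell))$ and $$C_n=\frac{(2\cdot3^{n+1})\,\mathbf{A}(\mathbb{S}^{n-1})}{\mathbf{A}\big(B(v,(2\cdot 3^{n+1})^{-1})\cap\mathbb{S}^{n-1}\big)}\ \ge1$$ for an arbitrary $v\in\mathbb{S}^{n-1}$ (the value is independent of $v$); here $B(v,r)$ is the open Euclidean ball in $\mathbb{R}^n$. In particular, bounded self-contracted curves in $\mathbb{R}^n$ have finite length.
   Context: Let $(X,d)$ be a metric space and $\ell\in(0,\infty]$. A map $\xi:[0,\ell)\to X$ (not necessarily continuous) is called self-contracted if $d(\xi(t_2),\xi(t_3))\le d(\xi(t_1),\xi(t_3))$ for all $0\le t_1\le t_2\le t_3<\ell$. Its length is $\mathsf L(\xi)=\sup\{\sum_{i=1}^k d(\xi(t_{i-1}),\xi(t_i)) : k\in\mathbb N,\ 0=t_0<t_1<\dots<t_k<\ell\}$. For $t\in[0,\ell)$, $\Xi(t):=\xi([t,\ell))$. In $\mathbb{R}^n$: $\mathbf{A}$ is the standard surface measure on the unit sphere $\mathbb{S}^{n-1}$; for $v\in\mathbb{S}^{n-1}$ and $\Omega\subset\mathbb{R}^n$, $\Pi_v(\Omega)$ is the smallest closed interval containing $\{\langle x,v\rangle:x\in\Omega\}$ and $|\cdot|$ is Lebesgue measure on $\mathbb{R}$; the mean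 width is $\mathsf W(\Omega):=\frac{1}{\mathbf{A}(\mathbb{S}^{n-1})}\int_{\mathbb{S}^{n-1}}|\Pi_v(\Omega)|\,\mathbf{A}(dv)$. *)

theory Defs
  imports "HOL-Analysis.Analysis"
begin

definition dom_cl :: "ereal \<Rightarrow> real set" where
  "dom_cl l = {t. 0 \<le> t \<and> ereal t < l}"

definition self_contracted :: "ereal \<Rightarrow> (real \<Rightarrow> 'a::metric_space) \<Rightarrow> bool" where
  "self_contracted l \<xi> \<longleftrightarrow>
     (\<forall>t1 t2 t3. 0 \<le> t1 \<and> t1 \<le> t2 \<and> t2 \<le> t3 \<and> ereal t3 < l \<longrightarrow>
        dist (\<xi> t2) (\<xi> t3) \<le> dist (\<xi> t1) (\<xi> t3))"

definition curve_length :: "ereal \<Rightarrow> (real \<Rightarrow> 'a::metric_space) \<Rightarrow> ennreal" where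
  "curve_length l \<xi> =
     (SUP p \<in> {(k::nat, t::nat \<Rightarrow> real). t 0 = 0 \<and> (\<forall>i<k. t i < t (Suc i)) \<and> ereal (t k) < l}.
        ennreal (\<Sum>i\<in>{1..fst p}. dist (\<xi> (snd p (i - 1))) (\<xi> (snd p i))))"

definition tail_set :: "ereal \<Rightarrow> (real \<Rightarrow> 'a) \<Rightarrow> real \<Rightarrow> 'a set" where
  "tail_set l \<xi> t = \<xi> ` {s. t \<le> s \<and> ereal s < l}"

text \<open>Standard surface measure on the unit sphere, realised as the cone measure:
  A(E) = n * Lebesgue measure of {x : 0 < |x| < 1, x/|x| \<in> E}.\<close>
definition sphere_measure :: "'a::euclidean_space measure" where
  "sphere_measure = scale_measure (of_nat DIM('a))
     (distr (restrict_space lborel (ball 0 1 - {0})) borel (\<lambda>x. x /\<^sub>R norm x))"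

definition proj_interval :: "'a::euclidean_space \<Rightarrow> 'a set \<Rightarrow> real set" where
  "proj_interval v \<Omega> =
     \<Inter> {I. closed I \<and> is_interval I \<and> (\<lambda>x. inner x v) ` \<Omega> \<subseteq> I}"

definition mean_width :: "'a::euclidean_space set \<Rightarrow> ennreal" where
  "mean_width \<Omega> =
     (\<integral>\<^sup>+ v\<in>sphere 0 1. emeasure lborel (proj_interval v \<Omega>) \<partial>(sphere_measure :: 'a measure))
       / emeasure (sphere_measure :: 'a measure) (sphere 0 1)"

definition ediam :: "'a::metric_space set \<Rightarrow> ennreal" where
  "ediam S = (SUP p \<in> S \<times> S. ennreal (dist (fst p) (snd p)))"

definition C_const :: "'a::euclidean_space \<Rightarrow> real" where
  "C_const v = (2 * 3 ^ (DIM('a) + 1)) * measure (sphere_measure :: 'a measure) (sphere 0 1)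
     / measure sphere_measure (ball v (1 / (2 * 3 ^ (DIM('a) + 1))) \<inter> sphere 0 1)"

end

theory Submission
  imports Defs
begin

text \<open>Seen from a point \<open>x\<close> of a self-contracted polygon, all later points span pairwise
  non-obtuse angles. By Caratheodory's theorem the convex hull of the corresponding unit vectors
  therefore keeps distance at least \<open>1 / sqrt (n + 1)\<close> from the origin, so its point closest to the
  origin gives a direction \<open>v\<close> such that for every \<open>w\<close> in the cap \<open>B(v, \<delta>)\<close>, where
  \<open>\<delta> = 1 / (2 * 3 ^ (n + 1))\<close>, all later points lie beyond \<open>x\<close> in direction \<open>w\<close>
  by at least \<open>\<delta>\<close> times the length of the step made at \<open>x\<close>. Hence, for fixed \<open>w\<close>, the width of
  the polygon in direction \<open>w\<close> dominates \<open>\<delta>\<close> times the sum of the steps whose cap contains \<open>w\<close>.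
  Integrating over the sphere gives the length bound, because all caps of radius \<open>\<delta>\<close> have the
  same measure.\<close>

section \<open>Orthogonal maps and Lebesgue measure\<close>

lemma nn_integral_lborel_translate:
  fixes h :: "'a::euclidean_space \<Rightarrow> ennreal"
  assumes "h \<in> borel_measurable borel"
  shows "(\<integral>\<^sup>+x. h (c + x) \<partial>lborel) = (\<integral>\<^sup>+x. h x \<partial>lborel)"
proof -
  have "(\<integral>\<^sup>+x. h x \<partial>lborel) = (\<integral>\<^sup>+x. h x \<partial>(distr lborel borel ((+) c)))"
    by (simp add: lborel_distr_plus)
  also have "\<dots> = (\<integral>\<^sup>+x. h (c + x) \<partial>lborel)"
    using assms by (subst nn_integral_distr) auto
  finally show ?thesis by simp
qed

text \<open>With \<open>U\<close> the unit ball, integrating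
  \<open>1\<^sub>U(x) 1\<^sub>B(x + f y)\<close> in the two orders gives \<open>|U| |f\<^sup>-\<^sup>1 B|\<close> and \<open>|U| |B|\<close>.\<close>
lemma emeasure_lborel_vimage_orthogonal:
  fixes f :: "'a::euclidean_space \<Rightarrow> 'a"
  assumes f: "orthogonal_transformation f" and B: "B \<in> sets borel"
  shows "emeasure lborel (f -` B) = emeasure lborel B"
proof -
  \<comment> \<open>A ball works because \<open>f\<close> preserves norms: for fixed
    \<open>x\<close>, the \<open>y\<close> with \<open>x - f y\<close> in \<open>U\<close> form the
    unit ball about \<open>g x\<close>, again of measure \<open>|U|\<close>. Positivity and
    finiteness of \<open>|U|\<close> allow the final cancellation.\<close>
  define U where "U = ball (0::'a) 1"
  define g where "g = inv f"
  have fg: "f (g x) = x" for x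
    using orthogonal_transformation_surj[OF f] by (simp add: g_def surj_f_inv_f)
  have lin: "linear f" using f by (rule orthogonal_transformation_linear)
  have [measurable]: "f \<in> borel_measurable borel"
    by (intro borel_measurable_continuous_onI linear_continuous_on linear_conv_bounded_linear[THEN iffD1] lin)
  have [measurable]: "B \<in> sets borel" "U \<in> sets borel" using B by (auto simp: U_def)
  have fB [measurable]: "f -` B \<in> sets borel"
    using measurable_sets[of f borel borel B] B by simp
  have "emeasure lborel U * emeasure lborel (f -` B) =
      (\<integral>\<^sup>+x. indicator U x * (\<integral>\<^sup>+y. indicator B (f y) \<partial>lborel) \<partial>lborel)"
    by (simp add: nn_integral_multc indicator_vimage[symmetric] fB del: indicator_vimage)
  also have "\<dots> = (\<integral>\<^sup>+x. \<integral>\<^sup>+y. indicator U x * indicator B (x + f y) \<partial>lborel \<partial>lborel)"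
  proof (rule nn_integral_cong)
    fix x :: 'a
    have "(\<integral>\<^sup>+y. indicator B (f y) \<partial>lborel) = (\<integral>\<^sup>+y. (indicator B (f (g x + y)) :: ennreal) \<partial>lborel)"
      by (rule nn_integral_lborel_translate[symmetric]) measurable
    also have "\<dots> = (\<integral>\<^sup>+y. indicator B (x + f y) \<partial>lborel)"
      by (simp add: linear_add[OF lin] fg)
    finally show "indicator U x * (\<integral>\<^sup>+y. indicator B (f y) \<partial>lborel) =
        (\<integral>\<^sup>+y. indicator U x * indicator B (x + f y) \<partial>lborel)"
      by (simp add: nn_integral_cmult)
  qed
  also have "\<dots> = (\<integral>\<^sup>+y. \<integral>\<^sup>+x. indicator U x * indicator B (x + f y) \<partial>lborel \<partial>lborel)"
    by (rule lborel_pair.Fubini') measurable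
  also have "\<dots> = (\<integral>\<^sup>+y. \<integral>\<^sup>+x. indicator U (x - f y) * indicator B x \<partial>lborel \<partial>lborel)"
  proof (rule nn_integral_cong)
    fix y :: 'a
    show "(\<integral>\<^sup>+x. indicator U x * indicator B (x + f y) \<partial>lborel) =
        (\<integral>\<^sup>+x. (indicator U (x - f y) * indicator B x :: ennreal) \<partial>lborel)"
      by (subst nn_integral_lborel_translate[of "\<lambda>x. indicator U (x - f y) * indicator B x" "f y", symmetric])
        (auto simp: add.commute)
  qed
  also have "\<dots> = (\<integral>\<^sup>+x. \<integral>\<^sup>+y. indicator U (x - f y) * indicator B x \<partial>lborel \<partial>lborel)"
    by (rule lborel_pair.Fubini') measurable
  also have "\<dots> = (\<integral>\<^sup>+x. emeasure lborel U * indicator B x \<partial>lborel)"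
  proof (rule nn_integral_cong)
    fix x :: 'a
    have "indicator U (x - f y) = (indicator U (- g x + y) :: ennreal)" for y
    proof -
      have "norm (x - f y) = norm (f (- g x + y))"
        by (simp add: linear_add[OF lin] linear_diff[OF lin] fg norm_minus_commute)
      then show ?thesis
        using orthogonal_transformation_norm[OF f] by (simp add: U_def indicator_def)
    qed
    then have "(\<integral>\<^sup>+y. indicator U (x - f y) \<partial>lborel) = emeasure lborel U"
      using nn_integral_lborel_translate[of "indicator U" "- g x"] by simp
    then show "(\<integral>\<^sup>+y. indicator U (x - f y) * indicator B x \<partial>lborel) = emeasure lborel U * indicator B x"
      by (simp add: nn_integral_multc)
  qed
  also have "\<dots> = emeasure lborel U * emeasure lborel B"
    by (simp add: nn_integral_cmult_indicator)
  finally have "emeasure lborel U * emeasure lborel (f -` B) = emeasure lborel U * emeasure lborel B" .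
  moreover have "emeasure lborel U \<noteq> 0" "emeasure lborel U \<noteq> top"
    using emeasure_lborel_ball_finite[of "0::'a" 1] content_ball_pos[of 1 "0::'a"]
    by (auto simp: U_def measure_def)
  ultimately show ?thesis
    by (simp add: ennreal_mult_cancel_left)
qed

text \<open>This is the reflection in the hyperplane orthogonal to \<open>a\<close>. The factor 2 is
  what makes the terms linear and quadratic in \<open>k\<close> cancel in the inner product of two
  images.\<close>

lemma orthogonal_transformation_householder:
  fixes a :: "'a::euclidean_space"
  assumes "a \<noteq> 0"
  shows "orthogonal_transformation (\<lambda>x. x - (2 * (x \<bullet> a) / (a \<bullet> a)) *\<^sub>R a)"
proof -
  define k where "k = 2 / (a \<bullet> a)"
  have k: "k * (a \<bullet> a) = 2" using assms by (simp add: k_def)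
  have "(x - (k * (x \<bullet> a)) *\<^sub>R a) \<bullet> (y - (k * (y \<bullet> a)) *\<^sub>R a) = x \<bullet> y" for x y
  proof -
    have "(x - (k * (x \<bullet> a)) *\<^sub>R a) \<bullet> (y - (k * (y \<bullet> a)) *\<^sub>R a) =
        x \<bullet> y - 2 * (k * (x \<bullet> a) * (y \<bullet> a)) + k * (a \<bullet> a) * (k * (x \<bullet> a) * (y \<bullet> a))"
      by (simp add: inner_diff_left inner_diff_right inner_commute)
    then show ?thesis by (simp add: k)
  qed
  moreover have "linear (\<lambda>x. x - (k * (x \<bullet> a)) *\<^sub>R a)"
    by (rule linearI) (simp_all add: inner_add_left distrib_left scaleR_add_left scaleR_diff_right mult.left_commute)
  moreover have "2 * (x \<bullet> a) / (a \<bullet> a) = k * (x \<bullet> a)" for x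
    by (simp add: k_def)
  ultimately show ?thesis
    unfolding orthogonal_transformation_def by simp
qed

text \<open>The reflection along \<open>u - w\<close> swaps the two vectors, since equal norms give
  \<open>2 * (u \<bullet> a) = a \<bullet> a\<close>. This transitivity is what compares caps with
  different centres.\<close>

lemma orthogonal_transformation_exists:
  fixes u w :: "'a::euclidean_space"
  assumes "norm u = norm w"
  obtains f where "orthogonal_transformation f" "f u = w"
proof (cases "u = w")
  case True
  then show ?thesis using that[of "\<lambda>x. x"] by simp
next
  case False
  define a where "a = u - w"
  have a: "a \<noteq> 0" "a \<bullet> a \<noteq> 0" using False by (auto simp: a_def)
  have "u \<bullet> u = w \<bullet> w" using assms by (simp add: norm_eq)
  then have "2 * (u \<bullet> a) = a \<bullet> a" by (simp add: a_def algebra_simps inner_commute)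
  then have "u - (2 * (u \<bullet> a) / (a \<bullet> a)) *\<^sub>R a = w" using a by (simp add: a_def)
  then show ?thesis using that orthogonal_transformation_householder[OF a(1)] by blast
qed

section \<open>Surface measure of spherical caps\<close>

lemma sets_sphere_measure [measurable_cong, simp]: "sets sphere_measure = sets borel"
  by (simp add: sphere_measure_def)

lemma cone_borel:
  fixes E :: "'a::euclidean_space set"
  assumes "E \<in> sets borel"
  shows "{x \<in> ball 0 1 - {0}. x /\<^sub>R norm x \<in> E} \<in> sets borel"
  using assms by measurable

lemma emeasure_sphere_measure:
  fixes E :: "'a::euclidean_space set"
  assumes "E \<in> sets borel"
  shows "emeasure sphere_measure E =
    of_nat DIM('a) * emeasure lborel {x \<in> ball 0 1 - {0}. x /\<^sub>R norm x \<in> E}"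
proof -
  let ?R = "restrict_space lborel (ball 0 1 - {0::'a})"
  have m: "(\<lambda>x. x /\<^sub>R norm x) \<in> measurable ?R borel"
    by (rule measurable_restrict_space1) measurable
  have "emeasure (distr ?R borel (\<lambda>x. x /\<^sub>R norm x)) E =
      emeasure ?R {x \<in> ball 0 1 - {0}. x /\<^sub>R norm x \<in> E}"
    using assms m by (subst emeasure_distr) (auto simp: space_restrict_space intro!: arg_cong2[where f=emeasure])
  also have "\<dots> = emeasure lborel {x \<in> ball 0 1 - {0}. x /\<^sub>R norm x \<in> E}"
    by (rule emeasure_restrict_space) auto
  finally show ?thesis by (simp add: sphere_measure_def)
qed

lemma emeasure_sphere_measure_finite: "emeasure sphere_measure (E :: 'a::euclidean_space set) < \<infinity>"
proof (cases "E \<in> sets borel")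
  case True
  have "emeasure lborel {x \<in> ball 0 1 - {0}. x /\<^sub>R norm x \<in> E} \<le> emeasure lborel (ball (0::'a) 1)"
    by (rule emeasure_mono) auto
  also have "\<dots> < \<infinity>" using emeasure_lborel_ball_finite by auto
  finally show ?thesis using True
    by (simp add: emeasure_sphere_measure ennreal_mult_less_top of_nat_less_top)
qed (simp add: emeasure_notin_sets)

text \<open>The cone over the cap is open, as normalisation is continuous away from the origin, and
  it contains \<open>v / 2\<close>; so it contains a ball of positive volume.\<close>

lemma emeasure_cap_pos:
  fixes v :: "'a::euclidean_space"
  assumes v: "norm v = 1" and r: "r > 0"
  shows "emeasure sphere_measure (ball v r \<inter> sphere 0 1) > 0"
proof -
  let ?K = "{x \<in> ball 0 1 - {0}. x /\<^sub>R norm x \<in> ball v r \<inter> sphere 0 1}"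
  have K: "?K = (ball 0 1 - {0}) \<inter> (\<lambda>x. x /\<^sub>R norm x) -` ball v r"
    by auto
  have "open ?K"
    unfolding K by (rule continuous_open_preimage) (auto intro!: continuous_intros)
  moreover have "(1/2) *\<^sub>R v \<in> ?K" using v r by auto
  ultimately obtain e where e: "e > 0" "ball ((1/2) *\<^sub>R v) e \<subseteq> ?K"
    by (rule openE)
  have "emeasure lborel (ball ((1/2) *\<^sub>R v) e) \<le> emeasure lborel ?K"
    using e cone_borel[of "ball v r \<inter> sphere 0 1"] by (intro emeasure_mono) auto
  moreover have "emeasure lborel (ball ((1/2) *\<^sub>R v) e) \<noteq> 0"
    using content_ball_pos[OF e(1), of "(1/2) *\<^sub>R v"] by (auto simp: measure_def)
  ultimately have "emeasure lborel ?K \<noteq> 0" by auto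
  then show ?thesis
    by (simp add: emeasure_sphere_measure zero_less_iff_neq_zero)
qed

text \<open>An orthogonal map taking \<open>u\<close> to \<open>w\<close> pulls the cone over the
  cap at \<open>w\<close> back to the cone over the cap at \<open>u\<close>, and it preserves
  volume.\<close>

lemma emeasure_cap_eq:
  fixes u w :: "'a::euclidean_space"
  assumes "norm u = norm w"
  shows "emeasure sphere_measure (ball u r \<inter> sphere 0 1) = emeasure sphere_measure (ball w r \<inter> sphere 0 1)"
proof -
  obtain f where f: "orthogonal_transformation f" "f u = w"
    using orthogonal_transformation_exists[OF assms] .
  let ?K = "\<lambda>v. {x \<in> ball 0 1 - {0}. x /\<^sub>R norm x \<in> ball v r \<inter> sphere 0 1}"
  have n: "norm (f x) = norm x" for x
    using f by (simp add: orthogonal_transformation_norm)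
  have lin: "linear f" using f orthogonal_transformation_linear by blast
  have d: "dist w (f x /\<^sub>R norm x) = dist u (x /\<^sub>R norm x)" for x
    using n[of "u - x /\<^sub>R norm x"] f(2) by (simp add: dist_norm linear_diff[OF lin] linear_scale[OF lin])
  have z: "f x = 0 \<longleftrightarrow> x = 0" for x using n[of x] by (metis norm_eq_zero)
  have "f -` ?K w = ?K u"
    by (auto simp: n d z)
  moreover have "emeasure lborel (f -` ?K w) = emeasure lborel (?K w)"
    by (rule emeasure_lborel_vimage_orthogonal[OF f(1) cone_borel]) auto
  ultimately show ?thesis by (simp add: emeasure_sphere_measure)
qed

section \<open>Common directions for non-obtuse configurations\<close>

text \<open>Expand the squared norm of a convex combination of at most \<open>n + 1\<close> vectors.
  The cross terms are non-negative, so the squared coefficients remain, and Cauchy-Schwarz bounds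
  their sum below by \<open>1 / (n + 1)\<close>.\<close>

lemma convex_hull_norm_lower_bound:
  fixes S :: "'a::euclidean_space set"
  assumes S: "\<And>u. u \<in> S \<Longrightarrow> norm u = 1" "\<And>u w. u \<in> S \<Longrightarrow> w \<in> S \<Longrightarrow> 0 \<le> u \<bullet> w"
    and y: "y \<in> convex hull S"
  shows "1 / (DIM('a) + 1) \<le> (norm y)\<^sup>2"
proof -
  obtain T c where T: "finite T" "T \<subseteq> S" "card T \<le> DIM('a) + 1" "\<forall>x\<in>T. 0 \<le> c x" "sum c T = 1"
      "(\<Sum>x\<in>T. c x *\<^sub>R x) = y"
    using y unfolding convex_hull_caratheodory by auto
  have "1 = (\<Sum>x\<in>T. c x)\<^sup>2" using T by simp
  also have "\<dots> \<le> (\<Sum>x\<in>T. (c x)\<^sup>2) * card T"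
    using sum_squared_le_sum_of_squares[of c T] by (simp add: mult.commute)
  also have "\<dots> \<le> (\<Sum>x\<in>T. (c x)\<^sup>2) * (DIM('a) + 1)"
    using T(3) by (intro mult_left_mono) (auto intro: sum_nonneg)
  finally have 1: "1 / (DIM('a) + 1) \<le> (\<Sum>x\<in>T. (c x)\<^sup>2)" by (simp add: field_simps)
  have "(\<Sum>x\<in>T. (c x)\<^sup>2) \<le> (\<Sum>x\<in>T. \<Sum>z\<in>T. c x * c z * (x \<bullet> z))"
  proof (rule sum_mono)
    fix x assume x: "x \<in> T"
    have "(c x)\<^sup>2 = c x * c x * (x \<bullet> x)"
      using S(1) T(2) x by (simp add: subset_iff power2_eq_square norm_eq_1)
    also have "\<dots> \<le> (\<Sum>z\<in>T. c x * c z * (x \<bullet> z))"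
      using T x S(2)[OF subsetD[OF T(2)] subsetD[OF T(2)]]
      by (intro member_le_sum) (auto intro!: mult_nonneg_nonneg)
    finally show "(c x)\<^sup>2 \<le> \<dots>" .
  qed
  also have "\<dots> = (norm y)\<^sup>2"
    unfolding T(6)[symmetric] power2_norm_eq_inner
    by (simp add: inner_sum_left inner_sum_right sum_distrib_left inner_commute ac_simps)
  finally show ?thesis using 1 by linarith
qed

lemma common_direction_exists:
  fixes S :: "'a::euclidean_space set"
  assumes S: "\<And>u. u \<in> S \<Longrightarrow> norm u = 1" "\<And>u w. u \<in> S \<Longrightarrow> w \<in> S \<Longrightarrow> 0 \<le> u \<bullet> w"
  obtains v where "norm v = 1" "\<And>u. u \<in> S \<Longrightarrow> 1 / sqrt (DIM('a) + 1) \<le> u \<bullet> v"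
proof (cases "S = {}")
  case True
  obtain b :: 'a where "b \<in> Basis" using nonempty_Basis by blast
  then show ?thesis using True that[of b] by simp
next
  case False
  \<comment> \<open>The closure guarantees a point closest to the origin; the norm bound is a closed
    condition and so survives.\<close>
  define K where "K = closure (convex hull S)"
  have K: "convex K" "closed K" "K \<noteq> {}" using False by (auto simp: K_def)
  define p where "p = closest_point K 0"
  have pK: "p \<in> K" using K by (simp add: p_def closest_point_in_set)
  have "K \<subseteq> {y. 1 / (DIM('a) + 1) \<le> (norm y)\<^sup>2}"
    unfolding K_def using convex_hull_norm_lower_bound[OF S]
    by (intro closure_minimal) (auto intro!: closed_Collect_le continuous_intros)
  then have np: "1 / (DIM('a) + 1) \<le> (norm p)\<^sup>2" using pK by auto
  then have np': "1 / sqrt (DIM('a) + 1) \<le> norm p"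
    by (metis real_sqrt_divide real_sqrt_le_iff real_sqrt_one real_sqrt_abs abs_norm_cancel)
  have p0: "norm p > 0"
    by (rule less_le_trans[OF _ np']) simp
  show ?thesis
  proof (rule that)
    show "norm (p /\<^sub>R norm p) = 1" using p0 by simp
    fix u assume "u \<in> S"
    then have "u \<in> K" by (metis K_def closure_subset hull_inc subsetD)
    \<comment> \<open>Variational inequality for the closest point: \<open>K\<close> lies beyond the
      hyperplane through \<open>p\<close> orthogonal to \<open>p\<close>.\<close>
    then have "(0 - p) \<bullet> (u - p) \<le> 0"
      unfolding p_def by (intro closest_point_dot K)
    then have "(norm p)\<^sup>2 \<le> u \<bullet> p" by (simp add: algebra_simps power2_norm_eq_inner inner_commute)
    then have "norm p \<le> u \<bullet> (p /\<^sub>R norm p)"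
      using p0 by (simp add: field_simps power2_eq_square)
    then show "1 / sqrt (DIM('a) + 1) \<le> u \<bullet> (p /\<^sub>R norm p)" using np' by linarith
  qed
qed

text \<open>The factor 3 is a budget: one \<delta> pays for tilting the direction from
  \<open>v\<close> to \<open>w\<close> within the cap, the other two for a step being at most twice
  as long as the distance to a later point.\<close>

lemma inverse_sqrt_Suc_ge: "3 * (1 / (2 * 3 ^ (n + 1))) \<le> 1 / sqrt (real n + 1)"
proof -
  have "sqrt (real n + 1) \<le> real n + 1"
    by (rule real_le_lsqrt) (auto simp: power2_eq_square field_simps)
  also have "\<dots> \<le> 2 * 3 ^ n"
  proof (induction n)
    case (Suc n)
    have "(1::real) \<le> 3 ^ n" by simp
    with Suc show ?case by simp
  qed simp
  finally show ?thesis by (simp add: field_simps)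
qed

text \<open>Here \<open>x\<close> is a vertex, \<open>x'\<close> the next one and \<open>Y\<close>
  the set of later ones. \<open>Y2\<close> is a disjunction because either of two later points may
  come first; both cases give a non-obtuse angle at \<open>x\<close>.\<close>

lemma cap_direction_exists:
  fixes x x' :: "'a::euclidean_space" and Y :: "'a set"
  assumes Y: "\<And>y. y \<in> Y \<Longrightarrow> dist x' y \<le> dist x y"
    and Y2: "\<And>y z. y \<in> Y \<Longrightarrow> z \<in> Y \<Longrightarrow> dist y z \<le> dist x z \<or> dist z y \<le> dist x y"
  defines "\<delta> \<equiv> 1 / (2 * 3 ^ (DIM('a) + 1)) :: real"
  obtains v where "norm v = 1"
    "\<And>y w. y \<in> Y \<Longrightarrow> w \<in> ball v \<delta> \<Longrightarrow> \<delta> * dist x x' \<le> (y - x) \<bullet> w"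
proof -
  have \<delta>: "\<delta> > 0" by (simp add: \<delta>_def)
  define S where "S = (\<lambda>y. sgn (y - x)) ` (Y - {x})"
  have "norm u = 1" if "u \<in> S" for u using that by (auto simp: S_def norm_sgn split: if_splits)
  moreover have "0 \<le> u \<bullet> w" if "u \<in> S" "w \<in> S" for u w
  proof -
    obtain y z where yz: "y \<in> Y" "z \<in> Y" "u = (y - x) /\<^sub>R norm (y - x)" "w = (z - x) /\<^sub>R norm (z - x)"
      using \<open>u \<in> S\<close> \<open>w \<in> S\<close> by (auto simp: S_def sgn_div_norm)
    \<comment> \<open>In the triangle \<open>x\<close>, \<open>a\<close>, \<open>b\<close>,
      expanding the square of \<open>a - b\<close> leaves \<open>(norm (a - x))\<^sup>2\<close> as a
      lower bound for twice the inner product.\<close>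
    have *: "0 \<le> (a - x) \<bullet> (b - x)" if "dist a b \<le> dist x b" for a b
    proof -
      have "norm ((a - x) - (b - x)) \<le> norm (b - x)"
        using that by (simp add: dist_norm norm_minus_commute)
      then have "(norm ((a - x) - (b - x)))\<^sup>2 \<le> (norm (b - x))\<^sup>2" by (simp add: power_mono)
      then have "(norm (a - x))\<^sup>2 \<le> 2 * ((a - x) \<bullet> (b - x))"
        by (simp add: power2_norm_eq_inner inner_diff_left inner_diff_right inner_commute)
      then show ?thesis using zero_le_power2[of "norm (a - x)"] by linarith
    qed
    have "0 \<le> (y - x) \<bullet> (z - x)"
      using Y2[OF yz(1,2)] *[of y z] *[of z y] by (auto simp: inner_commute)
    then show ?thesis by (simp add: yz)
  qed
  ultimately obtain v where v: "norm v = 1" "\<And>u. u \<in> S \<Longrightarrow> 1 / sqrt (DIM('a) + 1) \<le> u \<bullet> v"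
    using common_direction_exists[of S] by metis
  show ?thesis
  proof (rule that[OF v(1)])
    fix y w assume y: "y \<in> Y" and w: "w \<in> ball v \<delta>"
    show "\<delta> * dist x x' \<le> (y - x) \<bullet> w"
    proof (cases "y = x")
      \<comment> \<open>A later point can return to \<open>x\<close> and then has no direction, but
        contraction forces \<open>x' = x\<close>, so the step has length 0.\<close>
      case True
      then show ?thesis using Y[OF y] by simp
    next
      case False
      then have n: "norm (y - x) > 0" by simp
      have "(y - x) /\<^sub>R norm (y - x) \<in> S" using y False by (auto simp: S_def sgn_div_norm[symmetric])
      then have "1 / sqrt (DIM('a) + 1) \<le> ((y - x) /\<^sub>R norm (y - x)) \<bullet> v"
        by (rule v(2))
      then have "3 * \<delta> \<le> ((y - x) /\<^sub>R norm (y - x)) \<bullet> v"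
        using inverse_sqrt_Suc_ge[of "DIM('a)"] by (simp only: \<delta>_def of_nat_add of_nat_1)
      then have 1: "3 * \<delta> * norm (y - x) \<le> (y - x) \<bullet> v"
        using n pos_le_divide_eq[of "norm (y - x)" "3 * \<delta>" "(y - x) \<bullet> v"] by (simp add: divide_inverse_commute)
      have "(y - x) \<bullet> (v - w) \<le> norm (y - x) * norm (v - w)" by (rule norm_cauchy_schwarz)
      also have "\<dots> \<le> norm (y - x) * \<delta>"
        using w by (intro mult_left_mono) (auto simp: dist_norm)
      finally have 2: "2 * \<delta> * norm (y - x) \<le> (y - x) \<bullet> w" using 1 by (simp add: inner_diff_right algebra_simps)
      have "dist x x' \<le> 2 * norm (y - x)"
        using Y[OF y] dist_triangle[of x x' y] by (simp add: dist_norm norm_minus_commute)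
      then have "\<delta> * dist x x' \<le> \<delta> * (2 * norm (y - x))" using \<delta> by (intro mult_left_mono) auto
      with 2 show ?thesis by simp
    qed
  qed
qed

section \<open>Projection widths and mean width\<close>

lemma proj_interval_borel [measurable]: "proj_interval v \<Omega> \<in> sets borel"
  by (auto simp: proj_interval_def intro!: borel_closed)

text \<open>An interval containing two projections contains the segment between them; a negative
  difference is truncated to 0 by \<open>ennreal\<close>.\<close>

lemma emeasure_proj_interval_ge:
  assumes "x \<in> \<Omega>" "y \<in> \<Omega>"
  shows "ennreal ((y - x) \<bullet> v) \<le> emeasure lborel (proj_interval v \<Omega>)"
proof (cases "x \<bullet> v \<le> y \<bullet> v")
  case True
  have "{x \<bullet> v .. y \<bullet> v} \<subseteq> proj_interval v \<Omega>"
    unfolding proj_interval_def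
  proof (rule Inter_greatest)
    fix I assume "I \<in> {I. closed I \<and> is_interval I \<and> (\<lambda>x. x \<bullet> v) ` \<Omega> \<subseteq> I}"
    then have "is_interval I" "x \<bullet> v \<in> I" "y \<bullet> v \<in> I" using assms by auto
    then show "{x \<bullet> v .. y \<bullet> v} \<subseteq> I"
      unfolding is_interval_1 by (meson atLeastAtMost_iff subsetI)
  qed
  then have "emeasure lborel {x \<bullet> v .. y \<bullet> v} \<le> emeasure lborel (proj_interval v \<Omega>)"
    by (intro emeasure_mono) auto
  then show ?thesis using True by (simp add: inner_diff_left)
qed (simp add: ennreal_neg inner_diff_left)

text \<open>By Cauchy-Schwarz, projecting to a unit direction does not increase distances, so the
  interval from infimum to supremum has length at most the diameter.\<close>

lemma emeasure_proj_interval_le_ediam: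
  assumes v: "norm v = 1"
  shows "emeasure lborel (proj_interval v \<Omega>) \<le> ediam \<Omega>"
proof (cases "\<Omega> = {} \<or> ediam \<Omega> = top")
  case True
  \<comment> \<open>For the empty set the empty interval takes part in the intersection.\<close>
  moreover have "proj_interval v {} = {}" by (auto simp: proj_interval_def)
  ultimately show ?thesis by auto
next
  case False
  then obtain D where D: "ediam \<Omega> = ennreal D" "0 \<le> D" by (cases "ediam \<Omega>") auto
  let ?X = "(\<lambda>x. x \<bullet> v) ` \<Omega>"
  have d: "x \<bullet> v - y \<bullet> v \<le> D" if "x \<in> \<Omega>" "y \<in> \<Omega>" for x y
  proof -
    have "ennreal (dist x y) \<le> ediam \<Omega>"
      unfolding ediam_def using that by (intro SUP_upper2[of "(x, y)"]) auto
    then have "dist x y \<le> D" using D by simp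
    moreover have "(x - y) \<bullet> v \<le> norm (x - y) * norm v" by (rule norm_cauchy_schwarz)
    ultimately show ?thesis using v by (simp add: dist_norm inner_diff_left)
  qed
  obtain x0 where x0: "x0 \<in> \<Omega>" using False by auto
  have bdd: "bdd_above ?X" "bdd_below ?X"
    using d[OF _ x0] d[OF x0] by (auto intro!: bdd_aboveI[of _ "D + x0 \<bullet> v"] bdd_belowI[of _ "x0 \<bullet> v - D"] simp: algebra_simps)
  have "?X \<subseteq> {Inf ?X .. Sup ?X}" using bdd by (auto intro: cINF_lower cSUP_upper)
  then have sub: "proj_interval v \<Omega> \<subseteq> {Inf ?X .. Sup ?X}"
    by (auto simp: proj_interval_def is_interval_cc)
  have "Sup ?X \<le> D + Inf ?X"
  proof (rule cSup_least)
    fix a assume a: "a \<in> ?X"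
    have "a - D \<le> Inf ?X" using a d x0 by (intro cInf_greatest) (auto simp: algebra_simps)
    then show "a \<le> D + Inf ?X" by simp
  qed (use x0 in auto)
  moreover have "Inf ?X \<le> Sup ?X" using x0 bdd by (intro cInf_le_cSup) auto
  ultimately have "emeasure lborel {Inf ?X .. Sup ?X} \<le> ediam \<Omega>" using D by simp
  moreover have "emeasure lborel (proj_interval v \<Omega>) \<le> emeasure lborel {Inf ?X .. Sup ?X}"
    using sub by (intro emeasure_mono) auto
  ultimately show ?thesis by (rule order_trans[rotated])
qed

text \<open>The mean width averages widths bounded by the diameter; the total mass cancels because
  it is finite and, containing a cap, positive.\<close>

lemma mean_width_le_ediam: "mean_width (\<Omega> :: 'a::euclidean_space set) \<le> ediam \<Omega>"
proof -
  let ?M = "sphere_measure :: 'a measure"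
  obtain v :: 'a where v: "norm v = 1" using vector_choose_size[of 1] by auto
  have "0 < emeasure ?M (ball v 1 \<inter> sphere 0 1)" using v by (intro emeasure_cap_pos) auto
  also have "\<dots> \<le> emeasure ?M (sphere 0 1)" by (rule emeasure_mono) auto
  finally have pos: "emeasure ?M (sphere 0 1) \<noteq> 0" by simp
  have fin: "emeasure ?M (sphere 0 1) \<noteq> top" using emeasure_sphere_measure_finite[of "sphere (0::'a) 1"] by auto
  have "(\<integral>\<^sup>+ v\<in>sphere 0 1. emeasure lborel (proj_interval v \<Omega>) \<partial>?M) \<le>
      (\<integral>\<^sup>+ v. ediam \<Omega> * indicator (sphere 0 1) v \<partial>?M)"
    by (intro nn_integral_mono) (auto split: split_indicator intro!: emeasure_proj_interval_le_ediam)
  also have "\<dots> = ediam \<Omega> * emeasure ?M (sphere 0 1)"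
    by (rule nn_integral_cmult_indicator) auto
  finally have "mean_width \<Omega> \<le> ediam \<Omega> * emeasure ?M (sphere 0 1) / emeasure ?M (sphere 0 1)"
    unfolding mean_width_def by (rule divide_right_mono_ennreal)
  also have "\<dots> = ediam \<Omega>" using pos fin by (simp add: ennreal_mult_divide_eq)
  finally show ?thesis .
qed

section \<open>Length of self-contracted polygons\<close>

text \<open>Each step \<open>i\<close> with \<open>c i > 0\<close> moves the lower end of the extent of the later points
  down by at least \<open>c i\<close>; the other steps cannot shrink it.\<close>
lemma sum_steps_le_extent:
  fixes p :: "nat \<Rightarrow> 'a::real_inner" and c :: "nat \<Rightarrow> real"
  assumes "\<And>i. i < k \<Longrightarrow> c i \<le> 0 \<or> (\<forall>j. i < j \<and> j \<le> k \<longrightarrow> c i \<le> (p j - p i) \<bullet> w)" and "i \<le> k"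
  shows "\<exists>a b. i \<le> a \<and> a \<le> k \<and> b \<le> k \<and> (\<Sum>j=i..<k. c j) \<le> (p b - p a) \<bullet> w"
  using \<open>i \<le> k\<close>
\<comment> \<open>The induction runs backwards from the last vertex. It carries
  \<open>i \<le> a\<close> so that \<open>p a\<close> is later than the newly added vertex, which
  can then replace it as lower end.\<close>
proof (induction rule: inc_induct)
  case base
  show ?case by (intro exI[of _ k]) auto
next
  case (step n)
  then obtain a b where ab: "Suc n \<le> a" "a \<le> k" "b \<le> k" "(\<Sum>j=Suc n..<k. c j) \<le> (p b - p a) \<bullet> w"
    by blast
  have s: "(\<Sum>j=n..<k. c j) = c n + (\<Sum>j=Suc n..<k. c j)"
    using step by (simp add: sum.atLeast_Suc_lessThan)
  from assms(1)[OF step(2)] show ?case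
  proof
    assume "c n \<le> 0"
    then show ?thesis using ab s by (intro exI[of _ a] exI[of _ b]) auto
  next
    assume "\<forall>j. n < j \<and> j \<le> k \<longrightarrow> c n \<le> (p j - p n) \<bullet> w"
    then have "c n \<le> (p a - p n) \<bullet> w" using ab by auto
    then show ?thesis using ab s step
      by (intro exI[of _ n] exI[of _ b]) (auto simp: inner_diff_left)
  qed
qed

lemma self_contracted_polygon_length_le:
  fixes p :: "nat \<Rightarrow> 'a::euclidean_space" and v :: 'a
  assumes sc: "\<And>h i j. h \<le> i \<Longrightarrow> i \<le> j \<Longrightarrow> j \<le> k \<Longrightarrow> dist (p i) (p j) \<le> dist (p h) (p j)"
    and p\<Omega>: "\<And>i. i \<le> k \<Longrightarrow> p i \<in> \<Omega>" and v: "norm v = 1"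
  shows "ennreal (\<Sum>i<k. dist (p i) (p (Suc i))) \<le> ennreal (C_const v) * mean_width \<Omega>"
proof -
  let ?M = "sphere_measure :: 'a measure"
  define \<delta> :: real where "\<delta> = 1 / (2 * 3 ^ (DIM('a) + 1))"
  have \<delta>: "\<delta> > 0" by (simp add: \<delta>_def)
  define cap :: "'a \<Rightarrow> 'a set" where "cap u = ball u \<delta> \<inter> sphere 0 1" for u
  define L where "L = (\<Sum>i<k. dist (p i) (p (Suc i)))"
  have L: "0 \<le> L" by (simp add: L_def sum_nonneg)
  have "\<exists>u. norm u = 1 \<and> (\<forall>j w. i < j \<and> j \<le> k \<and> w \<in> ball u \<delta> \<longrightarrow>
      \<delta> * dist (p i) (p (Suc i)) \<le> (p j - p i) \<bullet> w)" if "i < k" for i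
  proof -
    obtain u where "norm u = 1" "\<And>y w. y \<in> p ` {Suc i..k} \<Longrightarrow> w \<in> ball u \<delta> \<Longrightarrow>
        \<delta> * dist (p i) (p (Suc i)) \<le> (y - p i) \<bullet> w"
    proof (rule cap_direction_exists[of "p ` {Suc i..k}" "p (Suc i)" "p i", folded \<delta>_def])
      fix y z assume "y \<in> p ` {Suc i..k}" "z \<in> p ` {Suc i..k}"
      then obtain a b where "y = p a" "z = p b" "Suc i \<le> a" "a \<le> k" "Suc i \<le> b" "b \<le> k" by auto
      then show "dist y z \<le> dist (p i) z \<or> dist z y \<le> dist (p i) y"
        using sc[of i a b] sc[of i b a] by (cases "a \<le> b") auto
    qed (auto intro: sc)
    then show ?thesis by (intro exI[of _ u]) auto
  qed
  then obtain u where u: "\<And>i. i < k \<Longrightarrow> norm (u i) = 1"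
    "\<And>i j w. i < j \<Longrightarrow> j \<le> k \<Longrightarrow> w \<in> ball (u i) \<delta> \<Longrightarrow> \<delta> * dist (p i) (p (Suc i)) \<le> (p j - p i) \<bullet> w"
    by (metis order_less_le_trans)
  have pointwise: "(\<Sum>i<k. ennreal (\<delta> * dist (p i) (p (Suc i))) * indicator (cap (u i)) w) \<le>
      emeasure lborel (proj_interval w \<Omega>) * indicator (sphere 0 1) w" for w
  proof (cases "w \<in> sphere 0 1")
    case False
    then show ?thesis by (auto simp: cap_def)
  next
    case True
    define c where "c i = \<delta> * dist (p i) (p (Suc i)) * indicator (cap (u i)) w" for i
    \<comment> \<open>A step whose cap misses \<open>w\<close> has \<open>c i = 0\<close>, the first
      alternative; otherwise the choice of \<open>u i\<close> gives the second.\<close>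
    have "\<exists>a b. 0 \<le> a \<and> a \<le> k \<and> b \<le> k \<and> (\<Sum>j=0..<k. c j) \<le> (p b - p a) \<bullet> w"
      using u(2) by (intro sum_steps_le_extent) (auto simp: c_def cap_def split: split_indicator)
    then obtain a b where ab: "a \<le> k" "b \<le> k" "(\<Sum>j<k. c j) \<le> (p b - p a) \<bullet> w"
      by (auto simp: lessThan_atLeast0)
    have "(\<Sum>i<k. ennreal (\<delta> * dist (p i) (p (Suc i))) * indicator (cap (u i)) w) = (\<Sum>i<k. ennreal (c i))"
      by (intro sum.cong) (auto simp: c_def split: split_indicator)
    also have "\<dots> = ennreal (\<Sum>i<k. c i)"
      using \<delta> by (intro sum_ennreal) (auto simp: c_def)
    also have "\<dots> \<le> ennreal ((p b - p a) \<bullet> w)" using ab by (intro ennreal_leI)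
    also have "\<dots> \<le> emeasure lborel (proj_interval w \<Omega>)"
      using ab p\<Omega> by (intro emeasure_proj_interval_ge) auto
    finally show ?thesis using True by simp
  qed
  have cap_sets: "cap x \<in> sets ?M" for x by (simp add: cap_def)
  let ?I = "\<integral>\<^sup>+ w\<in>sphere 0 1. emeasure lborel (proj_interval w \<Omega>) \<partial>?M"
  have "ennreal (\<delta> * L) * emeasure ?M (cap v) =
      (\<Sum>i<k. ennreal (\<delta> * dist (p i) (p (Suc i)))) * emeasure ?M (cap v)"
    using \<delta> by (simp add: L_def sum_distrib_left sum_ennreal)
  \<comment> \<open>All caps have the measure of the cap at \<open>v\<close>, so each summand may
    use its own cap; this turns the sum into an integral over the sphere.\<close>
  also have "\<dots> = (\<Sum>i<k. ennreal (\<delta> * dist (p i) (p (Suc i))) * emeasure ?M (cap (u i)))"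
    using emeasure_cap_eq[of "u _" v \<delta>] u(1) v
    by (auto simp: sum_distrib_right cap_def intro!: sum.cong)
  also have "\<dots> = (\<integral>\<^sup>+ w. (\<Sum>i<k. ennreal (\<delta> * dist (p i) (p (Suc i))) * indicator (cap (u i)) w) \<partial>?M)"
    using cap_sets by (subst nn_integral_sum) (auto simp: nn_integral_cmult_indicator)
  also have "\<dots> \<le> ?I"
    by (intro nn_integral_mono pointwise)
  finally have main: "ennreal (\<delta> * L) * emeasure ?M (cap v) \<le> ?I" .
  define s where "s = measure ?M (sphere 0 1)"
  define a where "a = measure ?M (cap v)"
  have es: "emeasure ?M (sphere 0 1) = ennreal s" and ea: "emeasure ?M (cap v) = ennreal a"
    using emeasure_sphere_measure_finite[of "sphere (0::'a) 1"] emeasure_sphere_measure_finite[of "cap v"]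
    by (auto simp: s_def a_def emeasure_eq_ennreal_measure)
  have "0 < emeasure ?M (cap v)" using emeasure_cap_pos[OF v \<delta>] by (simp add: cap_def)
  then have a: "a > 0" by (simp add: ea)
  have "emeasure ?M (cap v) \<le> emeasure ?M (sphere 0 1)" by (rule emeasure_mono) (auto simp: cap_def)
  then have s: "s > 0" using a by (simp add: es ea ennreal_le_iff2)
  have C: "C_const v = s / (\<delta> * a)"
    by (simp add: C_const_def s_def a_def \<delta>_def cap_def)
  \<comment> \<open>The factor \<open>s / (\<delta> * a)\<close> exactly undoes the weight
    \<open>\<delta> * a\<close> on the length and the normalisation by \<open>s\<close> in the mean
    width.\<close>
  have "ennreal L = ennreal (C_const v) * (ennreal (\<delta> * L) * ennreal a / ennreal s)"
    using L a s \<delta> by (simp add: C ennreal_mult[symmetric] divide_ennreal)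
  also have "\<dots> \<le> ennreal (C_const v) * mean_width \<Omega>"
    using main unfolding mean_width_def es ea
    by (intro mult_left_mono divide_right_mono_ennreal) auto
  finally show ?thesis by (simp add: L_def)
qed

section \<open>The constant, and passage from polygons to curves\<close>

lemma ediam_finite_if_bounded:
  assumes "bounded S"
  shows "ediam S < \<infinity>"
proof -
  obtain D where "\<And>x y. x \<in> S \<Longrightarrow> y \<in> S \<Longrightarrow> dist x y \<le> D"
    using assms by (meson bounded_two_points)
  then have "ediam S \<le> ennreal D"
    unfolding ediam_def by (intro SUP_least) (auto intro: ennreal_leI)
  then show ?thesis by (simp add: le_less_trans)
qed

lemma C_const_ge_1:
  fixes v :: "'a::euclidean_space"
  assumes "norm v = 1"
  shows "C_const v \<ge> 1"
proof -
  let ?M = "sphere_measure :: 'a measure"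
  let ?c = "ball v (1 / (2 * 3 ^ (DIM('a) + 1))) \<inter> sphere 0 1"
  have fin: "emeasure ?M E \<noteq> top" for E
    using emeasure_sphere_measure_finite[of E] by auto
  have "0 < emeasure ?M ?c" using assms by (intro emeasure_cap_pos) auto
  then have pos: "0 < measure ?M ?c"
    using fin[of ?c] by (simp add: emeasure_eq_ennreal_measure)
  have "measure ?M ?c \<le> measure ?M (sphere 0 1)"
    using fin by (intro measure_mono_fmeasurable fmeasurableI) (auto simp: top.not_eq_extremum)
  moreover have "(1::real) \<le> 2 * 3 ^ (DIM('a) + 1)"
    using one_le_power[of "3::real" "DIM('a) + 1"] by linarith
  ultimately have "1 * measure ?M ?c \<le> (2 * 3 ^ (DIM('a) + 1)) * measure ?M (sphere 0 1)"
    by (intro mult_mono) auto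
  then show ?thesis using pos unfolding C_const_def by simp
qed

lemma C_const_eq:
  fixes u v :: "'a::euclidean_space"
  assumes "norm u = norm v"
  shows "C_const u = C_const v"
  unfolding C_const_def measure_def emeasure_cap_eq[OF assms] ..

text \<open>Each partition in the supremum yields a self-contracted polygon with vertices on the
  curve, and the polygon bound does not depend on the partition.\<close>

lemma curve_length_le_mean_width:
  fixes \<xi> :: "real \<Rightarrow> 'a::euclidean_space"
  assumes sc: "self_contracted l \<xi>" and v: "norm (v::'a) = 1"
  shows "curve_length l \<xi> \<le> ennreal (C_const v) * mean_width (tail_set l \<xi> 0)"
  unfolding curve_length_def
proof (rule SUP_least, clarsimp)
  fix k and t :: "nat \<Rightarrow> real"
  assume t: "t 0 = 0" "\<forall>i<k. t i < t (Suc i)" "ereal (t k) < l"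
  \<comment> \<open>Partition times increase only up to index \<open>k\<close>; beyond it
    \<open>t\<close> is arbitrary.\<close>
  have mono: "t i \<le> t j" if "i \<le> j" "j \<le> k" for i j
    using that
  proof (induction rule: dec_induct)
    case (step n)
    then show ?case using t(2) by (metis Suc_le_eq less_imp_le order_trans)
  qed simp
  have lt: "ereal (t i) < l" if "i \<le> k" for i
    using mono[OF that] t(3) by (simp add: le_less_trans[of "ereal (t i)" "ereal (t k)"])
  have ge: "0 \<le> t i" if "i \<le> k" for i using mono[of 0 i] t(1) that by simp
  have "ennreal (\<Sum>i<k. dist (\<xi> (t i)) (\<xi> (t (Suc i)))) \<le> ennreal (C_const v) * mean_width (tail_set l \<xi> 0)"
  proof (rule self_contracted_polygon_length_le[where p = "\<lambda>i. \<xi> (t i)", OF _ _ v])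
    fix h i j assume "h \<le> i" "i \<le> j" "j \<le> k"
    then show "dist (\<xi> (t i)) (\<xi> (t j)) \<le> dist (\<xi> (t h)) (\<xi> (t j))"
      using sc mono lt ge unfolding self_contracted_def by (meson le_trans)
  qed (use ge lt in \<open>auto simp: tail_set_def\<close>)
  moreover have "(\<Sum>i=Suc 0..k. dist (\<xi> (t (i - Suc 0))) (\<xi> (t i))) = (\<Sum>i<k. dist (\<xi> (t i)) (\<xi> (t (Suc i))))"
    by (rule sum.reindex_bij_witness[of _ Suc "\<lambda>i. i - 1"]) auto
  ultimately show "ennreal (\<Sum>i=Suc 0..k. dist (\<xi> (t (i - Suc 0))) (\<xi> (t i))) \<le>
      ennreal (C_const v) * mean_width (tail_set l \<xi> 0)" by simp
qed

theorem mainTheorem5: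
  fixes \<xi> :: "real \<Rightarrow> 'a::euclidean_space" and l :: ereal and v :: 'a
  assumes "0 < l"
    and "self_contracted l \<xi>"
    and "v \<in> sphere 0 1"
  shows "curve_length l \<xi> \<le> ennreal (C_const v) * mean_width (tail_set l \<xi> 0)
       \<and> ennreal (C_const v) * mean_width (tail_set l \<xi> 0)
           \<le> ennreal (C_const v) * ediam (tail_set l \<xi> 0)
       \<and> C_const v \<ge> 1
       \<and> (\<forall>w::'a\<in>sphere 0 1. C_const w = C_const v)
       \<and> (bounded (tail_set l \<xi> 0) \<longrightarrow> curve_length l \<xi> < \<infinity>)"
proof -
  have v: "norm v = 1" using assms(3) by simp
  note 1 = curve_length_le_mean_width[OF assms(2) v]
  have 2: "ennreal (C_const v) * mean_width (tail_set l \<xi> 0) \<le> ennreal (C_const v) * ediam (tail_set l \<xi> 0)"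
    by (intro mult_left_mono mean_width_le_ediam) auto
  have "curve_length l \<xi> < \<infinity>" if "bounded (tail_set l \<xi> 0)"
    using order_trans[OF 1 2] ediam_finite_if_bounded[OF that]
    by (auto simp: ennreal_mult_less_top intro: le_less_trans)
  moreover have "C_const w = C_const v" if "w \<in> sphere 0 1" for w :: 'a
    by (rule C_const_eq) (use that v in simp)
  ultimately show ?thesis
    using 1 2 C_const_ge_1[OF v] by blast
qed

end
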